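(* Let $H=[h_1,h_2,\dots]$ be a transcendental semigroup. Then $I(H)\cap K(H)=\emptyset$.
   Context: A transcendental semigroup $H=[h_1,h_2,\dots]$ is the semigroup, under composition, generated by a (finite or countable) family $\{h_1,h_2,\dots\}$ of transcendental entire functions, i.e. the set of all finite compositions of the generators. The escaping set $I(H)$ is the set of all $z\in\mathbb{C}$ such that every sequence in $H$ diverges to infinity at $z$, i.e. $|f_n(z)|\to\infty$ for every sequence $(f_n)$ of pairwise distinct elements of $H$. The filled Julia set $K(H)$ is the set of all $z\in\mathbb{C}$ such that every sequence in $H$ has a subsequence which is bounded at $z$ (i.e. every sequence $(f_n)$ of elements of $H$ has a subsequence $(f_{n_k})$ with $(f_{n_k}(z))_k$ bounded). *)

theory Defs
  imports "HOL-Complex_Analysis.Complex_Analysis"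
begin

definition transcendental_entire :: "(complex \<Rightarrow> complex) \<Rightarrow> bool" where
  "transcendental_entire f \<longleftrightarrow> f holomorphic_on UNIV \<and> (\<nexists>p. f = poly p)"

text \<open>Finite compositions of one or more generators; the identity is not adjoined.\<close>

inductive_set comp_semigroup :: "(complex \<Rightarrow> complex) set \<Rightarrow> (complex \<Rightarrow> complex) set"
  for G :: "(complex \<Rightarrow> complex) set" where
  generator: "g \<in> G \<Longrightarrow> g \<in> comp_semigroup G"
| comp: "f \<in> comp_semigroup G \<Longrightarrow> g \<in> comp_semigroup G \<Longrightarrow> f \<circ> g \<in> comp_semigroup G"

text \<open>Countable includes finite. The generating family is nonempty, as usual for a
  semigroup \<open>[h\<^sub>1, h\<^sub>2, \<dots>]\<close>.\<close>

definition transcendental_semigroup :: "(complex \<Rightarrow> complex) set \<Rightarrow> bool" where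
  "transcendental_semigroup H \<longleftrightarrow>
     (\<exists>G. countable G \<and> G \<noteq> {} \<and> (\<forall>g\<in>G. transcendental_entire g) \<and> H = comp_semigroup G)"

text \<open>Sequences are required to be injective here: a constant sequence would otherwise
  make the set empty.\<close>

definition escaping_set :: "(complex \<Rightarrow> complex) set \<Rightarrow> complex set" where
  "escaping_set H = {z. \<forall>f :: nat \<Rightarrow> complex \<Rightarrow> complex. range f \<subseteq> H \<longrightarrow> inj f \<longrightarrow>
     filterlim (\<lambda>n. norm (f n z)) at_top sequentially}"

definition filled_julia_set :: "(complex \<Rightarrow> complex) set \<Rightarrow> complex set" where
  "filled_julia_set H = {z. \<forall>f :: nat \<Rightarrow> complex \<Rightarrow> complex. range f \<subseteq> H \<longrightarrow>
     (\<exists>r :: nat \<Rightarrow> nat. strict_mono r \<and> bounded (range (\<lambda>k. f (r k) z)))}"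

end

theory Submission
  imports Defs
begin

text \<open>
  A point in both sets would see the same sequence of values tend to infinity and be bounded
  along a subsequence. This is a contradiction as soon as there is a sequence to which both
  definitions apply, that is, a sequence of pairwise distinct elements of the semigroup; for a
  finite semigroup both sets would be the whole plane. So the content of the result is that a
  transcendental semigroup is infinite, and for this the iterates of a single transcendental
  entire function \<open>g\<close> are enough.

  Suppose that \<open>g ^^ m = g ^^ (m + k)\<close> with \<open>k > 0\<close>. Then \<open>g ^^ k\<close> is the identity on the range
  of \<open>g ^^ m\<close>, which is open because \<open>g\<close> is an open map, and therefore \<open>g ^^ k\<close> is the identity
  on the plane. Hence \<open>g\<close> has the entire function \<open>g ^^ (k - 1)\<close> as a left inverse. A continuous
  left inverse keeps \<open>g\<close> from being bounded along any sequence that tends to infinity, so \<open>g\<close> has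
  a pole at infinity and is a polynomial (\<open>entire_left_inverse_imp_poly\<close>), contrary to
  transcendence.
\<close>

lemma entire_at_infinity_imp_poly:
  fixes f :: "complex \<Rightarrow> complex"
  assumes "f holomorphic_on UNIV" and "filterlim f at_infinity at_infinity"
  shows "\<exists>p. f = poly p"
proof -
  have "((inverse \<circ> f) \<longlongrightarrow> 0) at_infinity"
    unfolding o_def by (rule filterlim_compose[OF tendsto_inverse_0 assms(2)])
  then obtain a n where "\<And>z. f z = (\<Sum>i\<le>n. a i * z ^ i)"
    using pole_at_infinity[OF assms(1)] by metis
  then have "f = poly (\<Sum>i\<le>n. monom (a i) i)"
    by (simp add: fun_eq_iff poly_sum poly_monom)
  then show ?thesis by blast
qed

text \<open>
  The left inverse maps the compact disc of radius \<open>r\<close> to a bounded set, and this set contains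
  every point at which the modulus of \<open>f\<close> is at most \<open>r\<close>.
\<close>

lemma entire_left_inverse_imp_poly:
  fixes f h :: "complex \<Rightarrow> complex"
  assumes "f holomorphic_on UNIV" and "continuous_on UNIV h" and inv: "\<And>z. h (f z) = z"
  shows "\<exists>p. f = poly p"
proof (rule entire_at_infinity_imp_poly[OF assms(1)])
  have "eventually (\<lambda>z. r \<le> norm (f z)) at_infinity" for r
  proof -
    have "compact (h ` cball 0 r)"
      by (intro compact_continuous_image continuous_on_subset[OF assms(2)]) auto
    then have "bounded (h ` cball 0 r)" by (rule compact_imp_bounded)
    then obtain B where B: "\<And>w. w \<in> cball 0 r \<Longrightarrow> norm (h w) \<le> B"
      unfolding bounded_iff by blast
    show ?thesis
    proof (rule eventually_at_infinityI[of "B + 1"])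
      fix z :: complex assume "B + 1 \<le> norm z"
      then show "r \<le> norm (f z)"
        using B[of "f z"] inv[of z] by (cases "r \<le> norm (f z)") auto
    qed
  qed
  then show "filterlim f at_infinity at_infinity"
    by (intro filterlim_norm_at_top_imp_at_infinity) (simp add: filterlim_at_top)
qed

lemma holomorphic_on_funpow:
  assumes "f holomorphic_on UNIV"
  shows "(f ^^ n) holomorphic_on UNIV"
proof (induction n)
  case 0
  show ?case by (simp add: id_def)
next
  case (Suc n)
  show ?case
    unfolding funpow.simps
    by (rule holomorphic_on_compose[OF Suc.IH]) (rule holomorphic_on_subset[OF assms], simp)
qed

lemma open_range_funpow:
  fixes f :: "complex \<Rightarrow> complex"
  assumes "f holomorphic_on UNIV" and "\<not> f constant_on UNIV"
  shows "open (range (f ^^ n))"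
proof (induction n)
  case (Suc n)
  have "open (f ` range (f ^^ n))"
    by (rule open_mapping_thm[OF assms(1) _ _ Suc.IH _ assms(2)]) auto
  then show ?case by (simp add: image_comp)
qed simp

lemma transcendental_entire_not_constant:
  assumes "transcendental_entire f"
  shows "\<not> f constant_on UNIV"
proof
  assume "f constant_on UNIV"
  then obtain c where "\<And>z. f z = c" unfolding constant_on_def by blast
  then have "f = poly [:c:]" by (simp add: fun_eq_iff)
  then show False using assms unfolding transcendental_entire_def by blast
qed

lemma transcendental_entire_funpow_neq_id:
  assumes "transcendental_entire f" and "k > 0"
  shows "f ^^ k \<noteq> id"
proof
  assume eq: "f ^^ k = id"
  have hol: "f holomorphic_on UNIV"
    using assms(1) by (simp add: transcendental_entire_def)
  have "f ^^ k = f ^^ (k - 1) \<circ> f"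
    using \<open>k > 0\<close> funpow_Suc_right[of "k - 1" f] by simp
  then have "(f ^^ (k - 1)) (f z) = z" for z
    using eq by (simp add: fun_eq_iff)
  moreover have "continuous_on UNIV (f ^^ (k - 1))"
    by (intro holomorphic_on_imp_continuous_on holomorphic_on_funpow hol)
  ultimately have "\<exists>p. f = poly p"
    using entire_left_inverse_imp_poly[OF hol] by blast
  then show False using assms(1) by (simp add: transcendental_entire_def)
qed

text \<open>
  An iterate need not be surjective, so a coincidence of two iterates cannot be cancelled
  directly; it is the identity theorem on the open range of the lower iterate that reduces it
  to \<open>f ^^ k = id\<close>.
\<close>

lemma transcendental_entire_inj_funpow:
  assumes "transcendental_entire f"
  shows "inj (\<lambda>n. f ^^ n)"
proof (rule linorder_injI)
  fix m n :: nat
  assume "m < n"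
  define k where "k = n - m"
  have "k > 0" and n: "n = k + m" using \<open>m < n\<close> by (auto simp: k_def)
  have hol: "f holomorphic_on UNIV"
    using assms by (simp add: transcendental_entire_def)
  show "f ^^ m \<noteq> f ^^ n"
  proof
    assume "f ^^ m = f ^^ n"
    then have "(f ^^ k) ((f ^^ m) x) = (f ^^ m) x" for x
      unfolding n funpow_add by (metis comp_apply)
    then have fixed: "(f ^^ k) w = w" if "w \<in> range (f ^^ m)" for w
      using that by blast
    have "(f ^^ k) z = z" for z
    proof (rule analytic_continuation_open[of "range (f ^^ m)" UNIV "f ^^ k" "\<lambda>w. w"])
      show "open (range (f ^^ m))"
        by (intro open_range_funpow hol transcendental_entire_not_constant assms)
    qed (auto intro: holomorphic_on_funpow hol fixed)
    then have "f ^^ k = id" by (simp add: fun_eq_iff)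
    then show False
      using transcendental_entire_funpow_neq_id[OF assms \<open>k > 0\<close>] by simp
  qed
qed

lemma funpow_in_comp_semigroup:
  assumes "g \<in> G"
  shows "g ^^ Suc n \<in> comp_semigroup G"
proof (induction n)
  case 0
  show ?case using comp_semigroup.generator[OF assms] by simp
next
  case (Suc n)
  show ?case
    using comp_semigroup.comp[OF comp_semigroup.generator[OF assms] Suc.IH]
    by (simp only: funpow.simps(2))
qed

lemma transcendental_semigroup_infinite:
  assumes "transcendental_semigroup H"
  shows "infinite H"
proof -
  obtain G g where H: "H = comp_semigroup G" and g: "g \<in> G" "transcendental_entire g"
    using assms unfolding transcendental_semigroup_def by blast
  have "inj (\<lambda>n. g ^^ Suc n)"
    using transcendental_entire_inj_funpow[OF g(2)] unfolding inj_def by blast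
  moreover have "range (\<lambda>n. g ^^ Suc n) \<subseteq> H"
    unfolding H using funpow_in_comp_semigroup[OF g(1)] by blast
  ultimately show ?thesis
    using range_inj_infinite infinite_super by blast
qed

theorem proposition4p19:
  fixes H :: "(complex \<Rightarrow> complex) set"
  assumes "transcendental_semigroup H"
  shows "escaping_set H \<inter> filled_julia_set H = {}"
proof (rule equals0I)
  fix z assume z: "z \<in> escaping_set H \<inter> filled_julia_set H"
  obtain f :: "nat \<Rightarrow> complex \<Rightarrow> complex" where f: "inj f" "range f \<subseteq> H"
    using infinite_countable_subset[OF transcendental_semigroup_infinite[OF assms]] by blast
  have lim: "filterlim (\<lambda>n. norm (f n z)) at_top sequentially"
    using z f unfolding escaping_set_def by blast
  obtain r :: "nat \<Rightarrow> nat" where r: "strict_mono r" and bdd: "bounded (range (\<lambda>k. f (r k) z))"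
    using z f unfolding filled_julia_set_def by blast
  obtain B where B: "\<And>k. norm (f (r k) z) \<le> B"
    using bdd by (auto simp: bounded_iff)
  have "filterlim (\<lambda>k. norm (f (r k) z)) at_top sequentially"
    by (rule filterlim_compose[OF lim filterlim_subseq[OF r]])
  then have "eventually (\<lambda>k. B < norm (f (r k) z)) sequentially"
    by (simp add: filterlim_at_top_dense)
  then show False
    using B unfolding eventually_sequentially by (meson leD order_refl)
qed

end
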